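(* Let $r\ge3$ and $1<s\le r$ be integers, let $a_1,\dots,a_r\in\Omega$ be defined recursively by $a_1=(a_r,\mathrm{id})\sigma$, $a_i=(\mathrm{id},a_{i-1})$ for $2\le i\le s-1$, $a_s=(\mathrm{id},a_{s-1})\sigma$, $a_i=(a_{i-1},\mathrm{id})$ for $s+1\le i\le r$, and let $G$ be the closed subgroup of $\Omega$ topologically generated by $a_1,\dots,a_r$. Then $G$ is torsion-free.
   Context: $T$ is the regular rooted binary tree whose vertices are finite words over $\{0,1\}$; $\Omega=\mathrm{Aut}(T)$ with its profinite topology; automorphisms act on the right and $\gamma\gamma'$ means first $\gamma$ then $\gamma'$. Every $\gamma\in\Omega$ is written uniquely as $(\gamma_0,\gamma_1)\tau$ with $\tau\in\{\mathrm{id},\sigma\}$, meaning $(xv)\gamma=(x)\tau\,(v)\gamma_x$ for a letter $x$ and word $v$; $\sigma=(\mathrm{id},\mathrm{id})\sigma$ swaps the first letter. Multiplication: $(\gamma_0,\gamma_1)\tau\cdot(\gamma_0',\gamma_1')\tau'=(\gamma_0\gamma'_{(0)\tau},\gamma_1\gamma'_{(1)\tau})\tau\tau'$. *)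

theory Defs
  imports "HOL-Analysis.Analysis" "HOL-Algebra.Algebra"
begin

text \<open>
  Vertices of the tree are words over \<^typ>\<open>bool\<close>, where \<^const>\<open>False\<close> stands for the letter 0
  and \<^const>\<open>True\<close> for the letter 1. The root is the empty word.
\<close>

type_synonym word = "bool list"

definition adjacent :: "word \<Rightarrow> word \<Rightarrow> bool" where
  "adjacent u v \<longleftrightarrow> (\<exists>x. v = u @ [x] \<or> u = v @ [x])"

definition tree_aut :: "(word \<Rightarrow> word) set" where
  "tree_aut = {f. bij f \<and> f [] = [] \<and> (\<forall>u v. adjacent (f u) (f v) \<longleftrightarrow> adjacent u v)}"

text \<open>
  Automorphisms act on the right: the product of \<open>f\<close> and \<open>g\<close> is first \<open>f\<close>, then \<open>g\<close>.
\<close>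

definition Omega :: "(word \<Rightarrow> word) monoid" where
  "Omega = \<lparr>carrier = tree_aut, mult = (\<lambda>f g. g \<circ> f), one = id\<rparr>"

text \<open>
  The profinite topology: the basic open sets are the cosets of the stabilizers of the levels
  up to \<open>n\<close>, i.e. the fibres of the restriction maps to the automorphism groups of the finite
  truncations of the tree.
\<close>

definition profinite_topology :: "(word \<Rightarrow> word) topology" where
  "profinite_topology = topology_generated_by
     {{g \<in> tree_aut. \<forall>w. length w \<le> n \<longrightarrow> g w = f w} | f n. f \<in> tree_aut}"

definition top_generate :: "(word \<Rightarrow> word) set \<Rightarrow> (word \<Rightarrow> word) set" where
  "top_generate A = profinite_topology closure_of (generate Omega A)"

text \<open>
  The map \<open>(g\<^sub>0, g\<^sub>1)\<tau>\<close>. The letter permutation \<open>\<tau>\<close> is \<^const>\<open>id\<close> or \<^const>\<open>Not\<close>, the latter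
  being the swap of the two letters.
\<close>

fun wreath :: "(word \<Rightarrow> word) \<Rightarrow> (word \<Rightarrow> word) \<Rightarrow> (bool \<Rightarrow> bool) \<Rightarrow> word \<Rightarrow> word" where
  "wreath g0 g1 t [] = []"
| "wreath g0 g1 t (x # v) = t x # (if x then g1 v else g0 v)"

definition torsion_free :: "('a, 'b) monoid_scheme \<Rightarrow> bool" where
  "torsion_free G \<longleftrightarrow>
     (\<forall>x \<in> carrier G. \<forall>n::nat. n > 0 \<longrightarrow> x [^]\<^bsub>G\<^esub> n = \<one>\<^bsub>G\<^esub> \<longrightarrow> x = \<one>\<^bsub>G\<^esub>)"

text \<open>
  The recursion defining the generators has a solution in tree automorphisms, so it is satisfiable.
\<close>

fun gen :: "nat \<Rightarrow> nat \<Rightarrow> nat \<Rightarrow> word \<Rightarrow> word" where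
  "gen r s i [] = []"
| "gen r s i (x # v) = (if i = 1 \<or> i = s then \<not> x else x) #
     (if i = 1 then (if x then v else gen r s r v)
      else if i \<le> s then (if x then gen r s (i - 1) v else v)
      else (if x then v else gen r s (i - 1) v))"

lemma length_gen: "length (gen r s i w) = length w"
  by (induction w arbitrary: i) auto

lemma inj_gen: "gen r s i u = gen r s i v \<Longrightarrow> u = v"
proof (induction u arbitrary: i v)
  case Nil
  then show ?case by (metis length_gen length_0_conv)
next
  case (Cons x u)
  from Cons.prems obtain y v' where v: "v = y # v'" by (cases v) auto
  show ?case using Cons v by (auto split: if_splits)
qed

lemma surj_gen: "\<exists>u. gen r s i u = v"
proof (induction v arbitrary: i)
  case Nil
  show ?case by (rule exI[of _ "[]"]) simp
next
  case (Cons y v)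
  define x where "x = (if i = 1 \<or> i = s then \<not> y else y)"
  obtain u1 u2 where "gen r s r u1 = v" "gen r s (i - 1) u2 = v" using Cons by metis
  then have "gen r s i (x # u1) = y # v \<or> gen r s i (x # u2) = y # v
      \<or> gen r s i (x # v) = y # v"
    by (auto simp: x_def)
  then show ?case by blast
qed

lemma gen_snoc: "\<exists>y. gen r s i (u @ [x]) = gen r s i u @ [y]"
  by (induction u arbitrary: i) auto

lemma gen_adjacent: "adjacent (gen r s i u) (gen r s i v) \<longleftrightarrow> adjacent u v"
proof
  have *: "\<exists>x. q = p @ [x]" if eq: "gen r s i q = gen r s i p @ [y]" for p q y
  proof -
    have "length q = Suc (length p)" using eq by (metis length_gen length_append_singleton)
    then obtain p' x where q: "q = p' @ [x]" by (metis length_Suc_conv_rev)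
    then have "gen r s i p' = gen r s i p" using eq gen_snoc[of r s i p' x] by auto
    then show ?thesis using q inj_gen by blast
  qed
  assume "adjacent (gen r s i u) (gen r s i v)"
  then show "adjacent u v" unfolding adjacent_def using * by blast
next
  assume "adjacent u v"
  then show "adjacent (gen r s i u) (gen r s i v)" unfolding adjacent_def using gen_snoc by blast
qed

lemma gen_in_Omega: "gen r s i \<in> carrier Omega"
  by (auto simp: Omega_def tree_aut_def gen_adjacent bij_def inj_def surj_def
      intro: inj_gen) (metis surj_gen)

lemma gen_recursion:
  assumes "1 < s"
  shows "gen r s 1 = wreath (gen r s r) id Not"
    and "2 \<le> i \<Longrightarrow> i \<le> s - 1 \<Longrightarrow> gen r s i = wreath id (gen r s (i - 1)) id"
    and "gen r s s = wreath id (gen r s (s - 1)) Not"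
    and "s + 1 \<le> i \<Longrightarrow> gen r s i = wreath (gen r s (i - 1)) id id"
proof -
  have ext: "f = g" if "f [] = g []" "\<And>x v. f (x # v) = g (x # v)" for f g :: "word \<Rightarrow> word"
  proof
    fix w show "f w = g w" using that by (cases w) auto
  qed
  show "gen r s 1 = wreath (gen r s r) id Not"
    by (rule ext) auto
  show "gen r s i = wreath id (gen r s (i - 1)) id" if "2 \<le> i" "i \<le> s - 1"
    by (rule ext) (use that assms in auto)
  show "gen r s s = wreath id (gen r s (s - 1)) Not"
    by (rule ext) (use assms in auto)
  show "gen r s i = wreath (gen r s (i - 1)) id id" if "s + 1 \<le> i"
    by (rule ext) (use that assms in auto)
qed

end

(* For a word in the generators let x_i be its exponent sum in a_i, the index i being read modulo r.
   The section words of (w_0, w_1)t have exponent vectors adding up to the cyclic shift of that of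
   (w_0, w_1)t, and the values of x_0 - x_{s-1} on w_0 and w_1 differ by 1 if t swaps the letters
   and by 0 otherwise. Hence x_1 - x_s has the parity of the action on the first level, and on words
   acting trivially there it is twice the value of x_0 - x_{s-1} on a section. Going once around
   the cycle of indices therefore gains a factor 2, so that x_1 - x_s extends to a continuous
   homomorphism from G to the 2-adic integers whose reduction modulo 2 is the action on the first
   level. A torsion element of G has value 0 and so fixes the first level; its sections are again
   torsion elements of G, and by recursion the element is trivial. *)

theory Submission
  imports Defs
begin

section \<open>Composition in wreath form, and the group and topology of tree automorphisms\<close>

lemma comp_wreath:
  "wreath h0 h1 u \<circ> wreath g0 g1 t =
     wreath ((if t False then h1 else h0) \<circ> g0) ((if t True then h1 else h0) \<circ> g1) (u \<circ> t)"
proof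
  fix w
  show "(wreath h0 h1 u \<circ> wreath g0 g1 t) w =
     wreath ((if t False then h1 else h0) \<circ> g0) ((if t True then h1 else h0) \<circ> g1) (u \<circ> t) w"
    by (cases w) auto
qed

lemma wreath_id: "wreath id id id = id"
proof
  fix w show "wreath id id id w = id w" by (cases w) auto
qed

lemma inv_tree_aut:
  assumes "f \<in> tree_aut"
  shows "inv_into UNIV f \<in> tree_aut"
proof -
  have f: "bij f" "f [] = []" "\<And>u v. adjacent (f u) (f v) \<longleftrightarrow> adjacent u v"
    using assms by (auto simp: tree_aut_def)
  have "f (inv_into UNIV f u) = u" for u using f(1) by (simp add: bij_is_surj surj_f_inv_f)
  then have "adjacent (inv_into UNIV f u) (inv_into UNIV f v) \<longleftrightarrow> adjacent u v" for u v
    using f(3)[of "inv_into UNIV f u" "inv_into UNIV f v"] by simp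
  moreover have "inv_into UNIV f [] = []" using f(1,2) by (metis bij_inv_eq_iff)
  ultimately show ?thesis using f(1) by (simp add: tree_aut_def bij_imp_bij_inv)
qed

lemma m_inv_Omega:
  assumes "f \<in> tree_aut"
  shows "inv\<^bsub>Omega\<^esub> f = inv_into UNIV f"
proof -
  have "bij f" using assms by (simp add: tree_aut_def)
  then have l: "inv_into UNIV f \<circ> f = id" and r: "f \<circ> inv_into UNIV f = id"
    by (auto simp: bij_def surj_iff)
  show ?thesis unfolding m_inv_def
  proof (rule the_equality)
    fix y assume "y \<in> carrier Omega \<and> f \<otimes>\<^bsub>Omega\<^esub> y = \<one>\<^bsub>Omega\<^esub> \<and> y \<otimes>\<^bsub>Omega\<^esub> f = \<one>\<^bsub>Omega\<^esub>"
    then have "f \<circ> y = id" "y \<circ> f = id" by (auto simp: Omega_def)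
    then show "y = inv_into UNIV f" by (metis inv_unique_comp)
  qed (use inv_tree_aut[OF assms] l r in \<open>auto simp: Omega_def\<close>)
qed

lemma nat_pow_Omega: "x [^]\<^bsub>Omega\<lparr>carrier := H\<rparr>\<^esub> (n::nat) = x ^^ n"
  by (induction n) (simp_all add: nat_pow_def Omega_def)

text \<open>The automorphisms agreeing with \<open>\<gamma>\<close> up to level \<open>n\<close>
  form a basic neighbourhood of \<open>\<gamma>\<close>, and every neighbourhood of a point of the
  closure meets the abstract subgroup.\<close>

lemma top_generate_approximable:
  assumes "\<gamma> \<in> top_generate A"
  shows "\<exists>g \<in> generate Omega A. \<forall>w. length w \<le> n \<longrightarrow> \<gamma> w = g w"
proof -
  let ?B = "{{g \<in> tree_aut. \<forall>w. length w \<le> n \<longrightarrow> g w = f w} | f n. f \<in> tree_aut}"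
  let ?U = "{g \<in> tree_aut. \<forall>w. length w \<le> n \<longrightarrow> g w = \<gamma> w}"
  have cl: "\<gamma> \<in> profinite_topology closure_of (generate Omega A)"
    using assms by (simp add: top_generate_def)
  then have "\<gamma> \<in> \<Union>?B"
    unfolding in_closure_of profinite_topology_def topology_generated_by_topspace by blast
  then have \<gamma>: "\<gamma> \<in> tree_aut" by auto
  then have "?U \<in> ?B" by blast
  then have U: "openin profinite_topology ?U"
    unfolding profinite_topology_def by (rule topology_generated_by_Basis)
  have "\<forall>T. \<gamma> \<in> T \<and> openin profinite_topology T \<longrightarrow> (\<exists>g. g \<in> generate Omega A \<and> g \<in> T)"
    using cl unfolding in_closure_of by (rule conjunct2)
  moreover have "\<gamma> \<in> ?U" using \<gamma> by simp
  ultimately have "\<exists>g. g \<in> generate Omega A \<and> g \<in> ?U" using U by (elim allE[of _ ?U]) simp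
  then obtain g where "g \<in> generate Omega A" "g \<in> ?U" by (elim exE conjE)
  then show ?thesis by (intro bexI[of _ g]) auto
qed

section \<open>Words in the generators and their exponent vectors\<close>

locale two_swap_recursion =
  fixes r s :: nat and a :: "nat \<Rightarrow> word \<Rightarrow> word"
  assumes s_gt: "1 < s" and s_le: "s \<le> r"
    and aut: "\<And>i. 1 \<le> i \<Longrightarrow> i \<le> r \<Longrightarrow> a i \<in> tree_aut"
    and rec1: "a 1 = wreath (a r) id Not"
    and rec_low: "\<And>i. 2 \<le> i \<Longrightarrow> i \<le> s - 1 \<Longrightarrow> a i = wreath id (a (i - 1)) id"
    and rec_s: "a s = wreath id (a (s - 1)) Not"
    and rec_high: "\<And>i. s + 1 \<le> i \<Longrightarrow> i \<le> r \<Longrightarrow> a i = wreath (a (i - 1)) id id"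
begin

text \<open>Reading indices modulo \<open>r\<close> identifies index 0 with \<open>r\<close>, so the
  section \<open>a r\<close> of \<open>a 1\<close> obeys the same shift by one as the other
  generators.\<close>

definition unit_exp :: "nat \<Rightarrow> nat \<Rightarrow> int" where
  "unit_exp i j = of_bool (j mod r = i mod r)"

text \<open>
  \<open>exponents g x\<close> says that some word in the generators evaluates to \<open>g\<close> and has the
  exponent vector \<open>x\<close>, extended periodically; \<open>x\<close> is not determined by \<open>g\<close>.
\<close>

inductive exponents :: "(word \<Rightarrow> word) \<Rightarrow> (nat \<Rightarrow> int) \<Rightarrow> bool" where
  one: "exponents id (\<lambda>_. 0)"
| gen: "1 \<le> i \<Longrightarrow> i \<le> r \<Longrightarrow> exponents (a i) (unit_exp i)"
| inverse: "exponents g x \<Longrightarrow> exponents (inv_into UNIV g) (\<lambda>j. - x j)"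
| mult: "exponents g x \<Longrightarrow> exponents h y \<Longrightarrow> exponents (h \<circ> g) (\<lambda>j. x j + y j)"

lemma exponents_bij: "exponents g x \<Longrightarrow> bij g"
proof (induction rule: exponents.induct)
  case (gen i)
  then show ?case using aut by (simp add: tree_aut_def)
qed (rule bij_id bij_imp_bij_inv bij_comp; assumption?)+

lemma exponents_periodic: "exponents g x \<Longrightarrow> x (j + r) = x j"
  by (induction rule: exponents.induct) (auto simp: unit_exp_def)

lemma exponents_funpow: "exponents g x \<Longrightarrow> exponents (g ^^ m) (\<lambda>j. int m * x j)"
proof (induction m)
  case 0
  show ?case using one by (simp add: id_def)
next
  case (Suc m)
  have "g ^^ Suc m = g \<circ> g ^^ m" "(\<lambda>j. int (Suc m) * x j) = (\<lambda>j. int m * x j + x j)"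
    by (simp_all add: algebra_simps)
  then show ?case using mult[OF Suc.IH[OF Suc.prems] Suc.prems] by metis
qed

lemma exponents_generate:
  assumes "g \<in> generate Omega (a ` {1..r})"
  shows "\<exists>x. exponents g x"
  using assms
proof (induction rule: generate.induct)
  case one
  have "\<one>\<^bsub>Omega\<^esub> = id" by (simp add: Omega_def)
  then show ?case using exponents.one by metis
next
  case (incl h)
  then show ?case using gen by force
next
  case (inv h)
  then obtain i where i: "1 \<le> i" "i \<le> r" "h = a i" by auto
  then show ?case using inverse[OF gen[OF i(1,2)]] m_inv_Omega[OF aut[OF i(1,2)]] by auto
next
  case (eng h1 h2)
  moreover have "h1 \<otimes>\<^bsub>Omega\<^esub> h2 = h2 \<circ> h1" by (simp add: Omega_def)
  ultimately show ?case using mult by metis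
qed

section \<open>Exponent vectors of sections and parity on the first level\<close>

definition sections ::
  "(word \<Rightarrow> word) \<Rightarrow> (nat \<Rightarrow> int) \<Rightarrow> (word \<Rightarrow> word) \<Rightarrow> (nat \<Rightarrow> int) \<Rightarrow>
    (word \<Rightarrow> word) \<Rightarrow> (nat \<Rightarrow> int) \<Rightarrow> (bool \<Rightarrow> bool) \<Rightarrow> bool" where
  "sections g x g0 x0 g1 x1 t \<longleftrightarrow>
     exponents g0 x0 \<and> exponents g1 x1 \<and> (t = id \<or> t = Not) \<and> g = wreath g0 g1 t \<and>
     (\<forall>j. x (Suc j) = x0 j + x1 j) \<and>
     (x0 0 - x0 (s - 1)) - (x1 0 - x1 (s - 1)) = of_bool (t False)"

lemma unit_exp_shift:
  assumes "1 \<le> i"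
  shows "unit_exp i (Suc j) = unit_exp (i - 1) j"
proof -
  have "Suc j mod r = Suc (i - 1) mod r \<longleftrightarrow> j mod r = (i - 1) mod r"
    by (metis mod_Suc Suc_inject nat.distinct(1))
  then show ?thesis using assms by (simp add: unit_exp_def)
qed

lemma sections_gen:
  assumes "1 \<le> i" "i \<le> r"
  shows "\<exists>g0 x0 g1 x1 t. sections (a i) (unit_exp i) g0 x0 g1 x1 t"
proof -
  \<comment> \<open>Only \<open>k = 1\<close> and \<open>k = s\<close> give a nonzero value, with
    opposite signs. The nontrivial section of \<open>a 1\<close> sits at letter 0 and that of
    \<open>a s\<close> at letter 1, so both swapping generators get difference 1.\<close>
  have e0: "unit_exp (k - 1) 0 - unit_exp (k - 1) (s - 1) = (if k = 1 then 1 else if k = s then -1 else 0)"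
    if "1 \<le> k" "k \<le> r" for k
    using that s_gt s_le by (auto simp: unit_exp_def)
  have er: "unit_exp r = unit_exp (1 - 1)" by (auto simp: unit_exp_def)
  have r1: "1 \<le> r" using s_gt s_le by simp
  consider "i = 1" | "2 \<le> i" "i \<le> s - 1" | "i = s" | "s + 1 \<le> i" using assms by linarith
  then show ?thesis
  proof cases
    case 1
    have "sections (a i) (unit_exp i) (a r) (unit_exp r) id (\<lambda>_. 0) Not"
      using gen[of r] one rec1 e0[of 1] unit_exp_shift[of 1] r1 er
      by (simp add: sections_def 1)
    then show ?thesis by blast
  next
    case 2
    have "sections (a i) (unit_exp i) id (\<lambda>_. 0) (a (i - 1)) (unit_exp (i - 1)) id"
      using gen[of "i - 1"] one rec_low[OF 2] e0[of i] unit_exp_shift[of i] 2 assms s_gt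
      by (simp add: sections_def)
    then show ?thesis by blast
  next
    case 3
    have "sections (a i) (unit_exp i) id (\<lambda>_. 0) (a (i - 1)) (unit_exp (i - 1)) Not"
      using gen[of "i - 1"] one rec_s e0[of i] unit_exp_shift[of i] assms s_gt
      by (simp add: sections_def 3)
    then show ?thesis by blast
  next
    case 4
    have "sections (a i) (unit_exp i) (a (i - 1)) (unit_exp (i - 1)) id (\<lambda>_. 0) id"
      using gen[of "i - 1"] one rec_high[OF 4] e0[of i] unit_exp_shift[of i] 4 assms s_gt
      by (simp add: sections_def)
    then show ?thesis by blast
  qed
qed

lemma sections_inverse:
  assumes "sections g x g0 x0 g1 x1 t"
  shows "\<exists>h0 y0 h1 y1 u. sections (inv_into UNIV g) (\<lambda>j. - x j) h0 y0 h1 y1 u"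
proof -
  have A: "exponents g0 x0" "exponents g1 x1" "t = id \<or> t = Not" "g = wreath g0 g1 t"
    using assms by (auto simp: sections_def)
  have b: "bij g0" "bij g1" using A exponents_bij by auto
  have c: "g0 \<circ> inv_into UNIV g0 = id" "inv_into UNIV g0 \<circ> g0 = id" "g1 \<circ> inv_into UNIV g1 = id" "inv_into UNIV g1 \<circ> g1 = id"
    using b by (auto simp: bij_def surj_iff)
  from A(3) show ?thesis
  proof
    assume t: "t = id"
    have "inv_into UNIV g = wreath (inv_into UNIV g0) (inv_into UNIV g1) id"
      by (rule inv_unique_comp) (simp_all add: A(4) t comp_wreath c wreath_id)
    then have "sections (inv_into UNIV g) (\<lambda>j. - x j) (inv_into UNIV g0) (\<lambda>j. - x0 j) (inv_into UNIV g1) (\<lambda>j. - x1 j) id"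
      using assms inverse by (simp add: sections_def t)
    then show ?thesis by blast
  next
    assume t: "t = Not"
    have n: "Not \<circ> Not = id" by auto
    have "inv_into UNIV g = wreath (inv_into UNIV g1) (inv_into UNIV g0) Not"
      by (rule inv_unique_comp) (simp_all add: A(4) t comp_wreath c n wreath_id)
    then have "sections (inv_into UNIV g) (\<lambda>j. - x j) (inv_into UNIV g1) (\<lambda>j. - x1 j) (inv_into UNIV g0) (\<lambda>j. - x0 j) Not"
      using assms inverse by (simp add: sections_def t)
    then show ?thesis by blast
  qed
qed

text \<open>When \<open>t\<close> swaps the letters, the sections of \<open>h\<close> are exchanged
  before they meet those of \<open>g\<close>, so the difference for \<open>h\<close> enters with the
  opposite sign. Two swaps thus give 1 - 1 = 0, and the last condition in \<open>sections\<close>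
  persists as an equality of integers.\<close>

lemma sections_mult:
  assumes "sections g x g0 x0 g1 x1 t" "sections h y h0 y0 h1 y1 u"
  shows "\<exists>k0 z0 k1 z1 v. sections (h \<circ> g) (\<lambda>j. x j + y j) k0 z0 k1 z1 v"
proof -
  have n: "Not \<circ> Not = id" by auto
  have "t = id \<or> t = Not" using assms by (auto simp: sections_def)
  then show ?thesis
  proof
    assume t: "t = id"
    have "sections (h \<circ> g) (\<lambda>j. x j + y j) (h0 \<circ> g0) (\<lambda>j. x0 j + y0 j)
        (h1 \<circ> g1) (\<lambda>j. x1 j + y1 j) u"
      using assms mult by (auto simp: sections_def t comp_wreath)
    then show ?thesis by blast
  next
    assume t: "t = Not"
    have "sections (h \<circ> g) (\<lambda>j. x j + y j) (h1 \<circ> g0) (\<lambda>j. x0 j + y1 j)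
        (h0 \<circ> g1) (\<lambda>j. x1 j + y0 j) (u \<circ> Not)"
      using assms mult by (auto simp: sections_def t comp_wreath n)
    then show ?thesis by blast
  qed
qed

lemma exponents_sections:
  "exponents g x \<Longrightarrow> \<exists>g0 x0 g1 x1 t. sections g x g0 x0 g1 x1 t"
proof (induction rule: exponents.induct)
  case one
  have "sections id (\<lambda>_. 0) id (\<lambda>_. 0) id (\<lambda>_. 0) id"
    using exponents.one by (simp add: sections_def wreath_id)
  then show ?case by blast
next
  case (gen i)
  then show ?case by (rule sections_gen)
next
  case (inverse g x)
  then show ?case using sections_inverse by blast
next
  case (mult g x h y)
  then obtain g0 x0 g1 x1 t h0 y0 h1 y1 u
    where "sections g x g0 x0 g1 x1 t" "sections h y h0 y0 h1 y1 u" by blast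
  then show ?case by (rule sections_mult)
qed

lemma exponents_length: "exponents g x \<Longrightarrow> length (g w) = length w"
proof (induction w arbitrary: g x)
  case Nil
  then show ?case using exponents_sections[OF Nil] by (auto simp: sections_def)
next
  case (Cons b w)
  then show ?case using exponents_sections[OF Cons.prems] by (auto simp: sections_def)
qed

lemma exponents_parity:
  assumes "exponents g x"
  shows "odd (x 1 - x s) \<longleftrightarrow> g [False] \<noteq> [False]"
proof -
  obtain g0 x0 g1 x1 t where S: "sections g x g0 x0 g1 x1 t"
    using exponents_sections[OF assms] by blast
  \<comment> \<open>The left side is the sum of the values of \<open>x 0 - x (s - 1)\<close> on the
    two sections; replacing the first value by the second plus \<open>of_bool (t False)\<close>
    leaves an even remainder.\<close>
  have "x 1 - x s = of_bool (t False) + 2 * (x1 0 - x1 (s - 1))"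
    using S s_gt spec[of "\<lambda>j. x (Suc j) = x0 j + x1 j" "s - 1"]
      spec[of "\<lambda>j. x (Suc j) = x0 j + x1 j" 0]
    by (simp add: sections_def)
  moreover have "g [False] = [t False]"
    using S exponents_length[of g0 x0 "[]"] by (simp add: sections_def)
  ultimately show ?thesis by (auto simp: of_bool_def)
qed

section \<open>2-adic continuity of the exponent differences\<close>

definition congruent_at :: "nat \<Rightarrow> nat \<Rightarrow> nat \<Rightarrow> bool" where
  "congruent_at n k j \<longleftrightarrow> (\<forall>g x. exponents g x \<longrightarrow> (\<forall>w. length w \<le> n \<longrightarrow> g w = w) \<longrightarrow>
     2 ^ k dvd x j - x (j + (s - 1)))"

lemma stabilizer_sections:
  assumes "exponents g x" "\<forall>w. length w \<le> Suc n \<longrightarrow> g w = w"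
  obtains g0 x0 g1 x1 where "sections g x g0 x0 g1 x1 id"
    "\<forall>w. length w \<le> n \<longrightarrow> g0 w = w" "\<forall>w. length w \<le> n \<longrightarrow> g1 w = w"
proof -
  obtain g0 x0 g1 x1 t where S: "sections g x g0 x0 g1 x1 t"
    using exponents_sections[OF assms(1)] by blast
  have g: "g = wreath g0 g1 t" using S by (simp add: sections_def)
  have "t False = False" using assms(2)[rule_format, of "[False]"] g by simp
  then have t: "t = id" using S by (auto simp: sections_def)
  show ?thesis
  proof (rule that)
    show "sections g x g0 x0 g1 x1 id" using S t by simp
    show "\<forall>w. length w \<le> n \<longrightarrow> g0 w = w"
      using assms(2)[rule_format, of "False # _"] g by simp
    show "\<forall>w. length w \<le> n \<longrightarrow> g1 w = w"
      using assms(2)[rule_format, of "True # _"] g by simp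
  qed
qed

text \<open>Sections of an element fixing levels up to \<open>Suc n\<close> fix levels up to
  \<open>n\<close>, and their exponent differences add up to the shifted one.\<close>

lemma congruent_at_shift:
  assumes "congruent_at n k j"
  shows "congruent_at (Suc n) k (Suc j)"
  unfolding congruent_at_def
proof (intro allI impI)
  fix g x assume "exponents g x" "\<forall>w. length w \<le> Suc n \<longrightarrow> g w = w"
  then obtain g0 x0 g1 x1 where S: "sections g x g0 x0 g1 x1 id"
    "\<forall>w. length w \<le> n \<longrightarrow> g0 w = w" "\<forall>w. length w \<le> n \<longrightarrow> g1 w = w"
    by (rule stabilizer_sections)
  then have "2 ^ k dvd (x0 j - x0 (j + (s - 1))) + (x1 j - x1 (j + (s - 1)))"
    using assms unfolding congruent_at_def sections_def by (intro dvd_add) auto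
  then show "2 ^ k dvd x (Suc j) - x (Suc j + (s - 1))"
    using S(1) by (simp add: sections_def algebra_simps)
qed

text \<open>With trivial action on the first letter both sections have the same value at index 0, so
  their sum is twice that value.\<close>

lemma congruent_at_double:
  assumes "congruent_at n k 0"
  shows "congruent_at (Suc n) (Suc k) 1"
  unfolding congruent_at_def
proof (intro allI impI)
  fix g x assume "exponents g x" "\<forall>w. length w \<le> Suc n \<longrightarrow> g w = w"
  then obtain g0 x0 g1 x1 where S: "sections g x g0 x0 g1 x1 id"
    "\<forall>w. length w \<le> n \<longrightarrow> g0 w = w" "\<forall>w. length w \<le> n \<longrightarrow> g1 w = w"
    by (rule stabilizer_sections)
  then have "2 ^ k dvd x0 0 - x0 (s - 1)"
    using assms unfolding congruent_at_def sections_def by fastforce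
  moreover have "x 1 - x (1 + (s - 1)) = 2 * (x0 0 - x0 (s - 1))"
    using S(1) by (simp add: sections_def)
  ultimately show "2 ^ Suc k dvd x 1 - x (1 + (s - 1))"
    by (simp only: power_Suc mult_dvd_mono dvd_refl)
qed

lemma congruent_at_zero:
  assumes "congruent_at n k r"
  shows "congruent_at n k 0"
  unfolding congruent_at_def
proof (intro allI impI)
  fix g x assume g: "exponents g x" "\<forall>w. length w \<le> n \<longrightarrow> g w = w"
  have "2 ^ k dvd x r - x (r + (s - 1))" using assms g by (auto simp: congruent_at_def)
  moreover have "x r = x 0" "x (r + (s - 1)) = x (s - 1)"
    using exponents_periodic[OF g(1), of 0] exponents_periodic[OF g(1), of "s - 1"]
    by (simp_all add: add.commute)
  ultimately show "2 ^ k dvd x 0 - x (0 + (s - 1))" by simp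
qed

text \<open>The step from index 0 to 1 gains a factor 2; further shifts, each costing one level,
  carry it to index \<open>r\<close>, which periodicity identifies with 0. Since the congruence is
  required of every exponent vector of \<open>g\<close>, the ambiguity of that vector is
  harmless.\<close>

lemma ex_congruent_at: "\<exists>n. congruent_at n k j"
proof (induction k arbitrary: j)
  case 0
  show ?case by (simp add: congruent_at_def)
next
  case (Suc k)
  have pos: "\<exists>n. congruent_at n (Suc k) (Suc i)" for i
  proof (induction i)
    case 0
    show ?case using Suc congruent_at_double by fastforce
  next
    case (Suc i)
    then show ?case using congruent_at_shift by blast
  qed
  show ?case
  proof (cases j)
    case 0
    have "Suc (r - 1) = r" using s_gt s_le by simp
    then show ?thesis using pos[of "r - 1"] congruent_at_zero 0 by auto
  qed (use pos in simp)
qed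

section \<open>Torsion elements of the closure\<close>

definition approximable :: "(word \<Rightarrow> word) \<Rightarrow> bool" where
  "approximable \<gamma> \<longleftrightarrow> (\<forall>n. \<exists>g x. exponents g x \<and> (\<forall>w. length w \<le> n \<longrightarrow> \<gamma> w = g w))"

lemma torsion_fixes_first_level:
  assumes "approximable \<gamma>" "\<gamma> ^^ m = id" "m > 0"
  shows "\<gamma> [False] = [False]"
proof (rule ccontr)
  assume odd: "\<gamma> [False] \<noteq> [False]"
  \<comment> \<open>The modulus \<open>2 ^ m\<close> is chosen because it exceeds \<open>m\<close>,
    hence cannot divide \<open>m\<close> times an odd number.\<close>
  obtain n where n: "congruent_at n m 1" using ex_congruent_at by blast
  \<comment> \<open>Level \<open>Suc n\<close> is at least 1, so \<open>g\<close> also has the same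
    action on the first letter as \<open>\<gamma>\<close>.\<close>
  obtain g x where g: "exponents g x" "\<forall>w. length w \<le> Suc n \<longrightarrow> \<gamma> w = g w"
    using assms(1) unfolding approximable_def by blast
  \<comment> \<open>As \<open>g\<close> preserves length, its iterates stay within the levels where
    it agrees with \<open>\<gamma>\<close>.\<close>
  have "length w \<le> Suc n \<Longrightarrow> (\<gamma> ^^ k) w = (g ^^ k) w" for k w
    by (induction k) (use g exponents_length[OF exponents_funpow[OF g(1)]] in auto)
  then have "\<forall>w. length w \<le> n \<longrightarrow> (g ^^ m) w = w" using assms(2) by (metis id_apply le_SucI)
  then have "2 ^ m dvd int m * x 1 - int m * x (1 + (s - 1))"
    using n exponents_funpow[OF g(1), of m] unfolding congruent_at_def by blast
  then have "2 ^ m dvd int m * (x 1 - x s)" using s_gt by (simp add: algebra_simps)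
  moreover have "odd (x 1 - x s)" using exponents_parity[OF g(1)] g(2) odd by simp
  then have "coprime (2 ^ m) (x 1 - x s)" by simp
  ultimately have "2 ^ m dvd int m" by (simp add: coprime_dvd_mult_left_iff)
  then have "(2::int) ^ m \<le> int m" by (rule zdvd_imp_le) (use assms(3) in simp)
  moreover have "int m < 2 ^ m" by (metis less_exp of_nat_less_iff of_nat_numeral of_nat_power)
  ultimately show False by linarith
qed

lemma approximable_section:
  assumes "approximable \<gamma>" "\<gamma> [False] = [False]"
  obtains \<delta> where "approximable \<delta>" "\<And>v. \<gamma> (b # v) = b # \<delta> v"
proof (rule that)
  \<comment> \<open>Dropping the first letter gives the section at \<open>b\<close>, since the
    approximations show that \<open>\<gamma>\<close> keeps that letter.\<close>
  let ?\<delta> = "\<lambda>v. tl (\<gamma> (b # v))"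
  have ap: "\<exists>h y. exponents h y \<and> (\<forall>v. length v \<le> n \<longrightarrow> \<gamma> (b # v) = b # h v)" for n
  proof -
    obtain g x where g: "exponents g x" "\<forall>w. length w \<le> Suc n \<longrightarrow> \<gamma> w = g w"
      using assms(1) unfolding approximable_def by blast
    obtain g0 x0 g1 x1 t where S: "sections g x g0 x0 g1 x1 t"
      using exponents_sections[OF g(1)] by blast
    have "g [False] = [False]" using g(2)[rule_format, of "[False]"] assms(2) by simp
    then have "t = id" using S by (auto simp: sections_def)
    then have "\<forall>v. length v \<le> n \<longrightarrow> \<gamma> (b # v) = b # (if b then g1 else g0) v"
      using S g(2) by (simp add: sections_def)
    moreover have "exponents (if b then g1 else g0) (if b then x1 else x0)"
      using S by (simp add: sections_def)
    ultimately show ?thesis by blast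
  qed
  show "\<gamma> (b # v) = b # ?\<delta> v" for v using ap[of "length v"] by force
  show "approximable ?\<delta>" unfolding approximable_def
  proof
    fix n
    show "\<exists>h y. exponents h y \<and> (\<forall>v. length v \<le> n \<longrightarrow> ?\<delta> v = h v)"
      using ap[of n] by (metis list.sel(3))
  qed
qed

lemma torsion_trivial:
  assumes "approximable \<gamma>" "\<gamma> ^^ m = id" "m > 0"
  shows "\<gamma> w = w"
  using assms
proof (induction w arbitrary: \<gamma>)
  case Nil
  obtain g x where "exponents g x" "\<forall>w. length w \<le> 0 \<longrightarrow> \<gamma> w = g w"
    using Nil(1) unfolding approximable_def by blast
  then show ?case using exponents_length[of g x "[]"] by simp
next
  case (Cons b w)
  obtain \<delta> where \<delta>: "approximable \<delta>" "\<And>v. \<gamma> (b # v) = b # \<delta> v"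
    using approximable_section[OF Cons.prems(1) torsion_fixes_first_level[OF Cons.prems]] by blast
  \<comment> \<open>Because \<open>\<gamma>\<close> fixes the first letter, taking the section
    commutes with powers, and \<open>\<delta>\<close> inherits the same exponent
    \<open>m\<close>.\<close>
  have "(\<gamma> ^^ k) (b # v) = b # (\<delta> ^^ k) v" for k v
    by (induction k) (simp_all add: \<delta>(2))
  then have "\<delta> ^^ m = id" using Cons.prems(2) by (metis ext id_apply list.inject)
  then show ?case using Cons.IH[OF \<delta>(1)] Cons.prems(3) \<delta>(2) by simp
qed

lemma torsion_free_top_generate: "torsion_free (Omega\<lparr>carrier := top_generate (a ` {1..r})\<rparr>)"
  unfolding torsion_free_def nat_pow_Omega
proof (intro ballI allI impI)
  fix \<gamma> and m :: nat
  assume \<gamma>: "\<gamma> \<in> carrier (Omega\<lparr>carrier := top_generate (a ` {1..r})\<rparr>)" and m: "m > 0"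
    and p: "\<gamma> ^^ m = \<one>\<^bsub>Omega\<lparr>carrier := top_generate (a ` {1..r})\<rparr>\<^esub>"
  have "\<gamma> \<in> top_generate (a ` {1..r})" using \<gamma> by simp
  then have "approximable \<gamma>" unfolding approximable_def
    using top_generate_approximable exponents_generate by meson
  moreover have "\<gamma> ^^ m = id" using p by (simp add: Omega_def)
  ultimately have "\<gamma> = id" using torsion_trivial m by (metis ext id_apply)
  then show "\<gamma> = \<one>\<^bsub>Omega\<lparr>carrier := top_generate (a ` {1..r})\<rparr>\<^esub>" by (simp add: Omega_def)
qed

end

theorem theorem6p8:
  fixes r s :: nat and a :: "nat \<Rightarrow> word \<Rightarrow> word"
  assumes "r \<ge> 3" and "1 < s" and "s \<le> r"
    and "\<And>i. 1 \<le> i \<Longrightarrow> i \<le> r \<Longrightarrow> a i \<in> carrier Omega"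
    and "a 1 = wreath (a r) id Not"
    and "\<And>i. 2 \<le> i \<Longrightarrow> i \<le> s - 1 \<Longrightarrow> a i = wreath id (a (i - 1)) id"
    and "a s = wreath id (a (s - 1)) Not"
    and "\<And>i. s + 1 \<le> i \<Longrightarrow> i \<le> r \<Longrightarrow> a i = wreath (a (i - 1)) id id"
  shows "torsion_free (Omega\<lparr>carrier := top_generate (a ` {1..r})\<rparr>)"
proof -
  interpret two_swap_recursion r s a
    by unfold_locales (use assms in \<open>auto simp: Omega_def\<close>)
  show ?thesis by (rule torsion_free_top_generate)
qed

end
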